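(* Let $k\ge 3$. For every $n\ge 1$ and all integers $i,j\ge 0$, $\varphi_k^n(ki+j)=(ki)\oplus\varphi_k^n(j)$.
   Context: The alphabet is $\mathbb{N}=\{0,1,2,\dots\}$. For an integer $k\ge 3$, $\varphi_k$ is the morphism of $\mathbb{N}^*$ defined on letters, for $i\ge 0$ and $0\le j\le k-1$, by $\varphi_k(ki+j)=(ki)(ki+j+1)$ (two letters) if $0\le j\le k-2$, and $\varphi_k(ki+k-1)=(ki+k)$ (one letter). For a finite word $W$ and integer $m$, $m\oplus W$ is the word obtained by adding $m$ to each letter of $W$. *)

theory Defs
  imports Main
begin

text \<open>Finite words over the alphabet of natural numbers are lists of type \<^typ>\<open>nat list\<close>.\<close>

text \<open>The image of a letter \<open>a\<close> is given by its decomposition \<open>a = k * i + j\<close> with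
  \<open>i = a div k\<close> and \<open>j = a mod k\<close>. The definition is meant for \<open>k \<ge> 3\<close>.\<close>

definition phi_letter :: "nat \<Rightarrow> nat \<Rightarrow> nat list" where
  "phi_letter k a =
     (let i = a div k; j = a mod k
      in if j \<le> k - 2 then [k * i, k * i + j + 1] else [k * i + k])"

definition phi :: "nat \<Rightarrow> nat list \<Rightarrow> nat list" where
  "phi k w = concat (map (phi_letter k) w)"

text \<open>The shift of a word by \<open>m\<close>. Only shifts by natural numbers are needed, and these stay
  within the alphabet.\<close>

definition shift_word :: "nat \<Rightarrow> nat list \<Rightarrow> nat list"  (infixr \<open>\<oplus>\<close> 65) where
  "m \<oplus> w = map (\<lambda>a. m + a) w"

lemma phi_Nil: "phi k [] = []"
  by (simp add: phi_def)

lemma phi_append: "phi k (u @ v) = phi k u @ phi k v"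
  by (simp add: phi_def)

lemma phi_two_letters:
  assumes "k \<ge> 3" "j \<le> k - 2"
  shows "phi k [k * i + j] = [k * i, k * i + j + 1]"
proof -
  have "j < k" using assms by simp
  then show ?thesis using assms by (simp add: phi_def phi_letter_def Let_def)
qed

lemma phi_one_letter:
  assumes "k \<ge> 3"
  shows "phi k [k * i + k - 1] = [k * i + k]"
proof -
  obtain r where r: "k = Suc r" using assms by (cases k) auto
  have eq: "k * i + k - 1 = k * i + r" using r by simp
  have "r < k" using r by simp
  then have "(k * i + r) div k = i" "(k * i + r) mod k = r" by simp_all
  moreover have "\<not> r \<le> k - 2" using r assms by simp
  ultimately show ?thesis unfolding eq by (simp add: phi_def phi_letter_def Let_def)
qed

end

theory Submission
  imports Defs
begin

text \<open>Adding \<open>k * i\<close> to a letter raises its quotient by \<open>k\<close> and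
  keeps its remainder: the same case of \<open>phi_letter\<close> applies, and each output letter
  grows by \<open>k * i\<close>. So this shift commutes with \<open>phi k\<close> on letters, hence
  on words, hence with all iterates.\<close>

lemma phi_letter_add:
  assumes "k > 0"
  shows "phi_letter k (k * i + a) = (k * i) \<oplus> phi_letter k a"
  using assms by (simp add: phi_letter_def shift_word_def Let_def algebra_simps)

text \<open>Whole words are needed: the induction on \<open>n\<close> applies this to
  \<open>(phi k ^^ n) w\<close>.\<close>

lemma phi_shift_word:
  assumes "k > 0"
  shows "phi k ((k * i) \<oplus> w) = (k * i) \<oplus> phi k w"
proof (induction w)
  case Nil
  then show ?case by (simp add: phi_def shift_word_def)
next
  case (Cons a w)
  then show ?case
    using phi_letter_add[OF assms, of i a] by (simp add: phi_def shift_word_def)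
qed

lemma funpow_phi_shift_word:
  assumes "k > 0"
  shows "(phi k ^^ n) ((k * i) \<oplus> w) = (k * i) \<oplus> (phi k ^^ n) w"
  by (induction n) (simp_all add: phi_shift_word[OF assms])

theorem theorem3p2:
  fixes k n i j :: nat
  assumes "k \<ge> 3"
    and "n \<ge> 1"
  shows "(phi k ^^ n) [k * i + j] = (k * i) \<oplus> (phi k ^^ n) [j]"
  \<comment> \<open>The word \<open>[k * i + j]\<close> is the shift of \<open>[j]\<close> by
    \<open>k * i\<close>.\<close>
  using funpow_phi_shift_word[of k n i "[j]"] assms by (simp add: shift_word_def)

end
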